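(* Let $\mathcal{A}$ be any alphabet set (a discrete set, finite or infinite, or a metric space $(\mathcal{A},d)$) containing at least two elements, let $\Omega=\mathcal{A}^{\mathbb{N}}$ be the full shift space with shift map $\sigma$, and let $\overline{\sigma}$ be the induced map on the hyperspace $\mathcal{K}(\Omega)$ of nonempty compact subsets of $\Omega$. Then: 1. $(\Omega,\sigma)$ is Li-Yorke sensitive. 2. $(\mathcal{K}(\Omega),\overline{\sigma})$ is Li-Yorke sensitive.
   Context: Sequences in $\mathcal{A}^{\mathbb{N}}$ are indexed from $0$, and $\sigma(x_0x_1x_2\ldots)=x_1x_2x_3\ldots$. The space $\mathcal{A}^{\mathbb{N}}$ carries the metric $D$, where $D(\bar x,\bar y)=\sum_{i=0}^\infty \frac{\delta(x_i,y_i)}{2^i}$ ($\delta$ the discrete metric) if $\mathcal{A}$ is a discrete alphabet, and $D(\bar x,\bar y)=\sum_{i=0}^\infty \frac{1}{2^i}\frac{d(x_i,y_i)}{1+d(x_i,y_i)}$ if $\mathcal{A}$ is a general metric space $(\mathcal{A},d)$. $\mathcal{K}(\Omega)$ is the set of nonempty compact subsets of $\Omega$ with the Hausdorff metric $D_H$ induced by $D$, and $\overline{\sigma}(K)=\sigma(K)=\{\sigma(\bar x):\bar x\in K\}$. A continuous self-map $f$ of a metric space $(X,\rho)$ is Li-Yorke sensitive if there exists $\delta>0$ such that for each $x\in X$ and each $\epsilon>0$ there exists $y\in X$ with $\rho(x,y)<\epsilon$, $\liminf_{n\to\infty}\rho(f^n(x),f^n(y))=0$ and $\limsup_{n\to\infty}\rho(f^n(x),f^n(y))>\delta$.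 *)

theory Defs
  imports "HOL-Analysis.Analysis"
begin

definition full_shift :: "'a set \<Rightarrow> (nat \<Rightarrow> 'a) set" where
  "full_shift A = UNIV \<rightarrow> A"

definition shift :: "(nat \<Rightarrow> 'a) \<Rightarrow> nat \<Rightarrow> 'a" where
  "shift x = (\<lambda>i. x (Suc i))"

definition seq_dist_discrete :: "(nat \<Rightarrow> 'a) \<Rightarrow> (nat \<Rightarrow> 'a) \<Rightarrow> real" where
  "seq_dist_discrete x y = (\<Sum>i. discrete_metric.dd (x i) (y i) / 2 ^ i)"

definition seq_dist_metric :: "('a \<Rightarrow> 'a \<Rightarrow> real) \<Rightarrow> (nat \<Rightarrow> 'a) \<Rightarrow> (nat \<Rightarrow> 'a) \<Rightarrow> real" where
  "seq_dist_metric d x y = (\<Sum>i. 1 / 2 ^ i * (d (x i) (y i) / (1 + d (x i) (y i))))"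

definition hyperspace :: "'b set \<Rightarrow> ('b \<Rightarrow> 'b \<Rightarrow> real) \<Rightarrow> 'b set set" where
  "hyperspace X \<rho> = {K. K \<noteq> {} \<and> compactin (Metric_space.mtopology X \<rho>) K}"

text \<open>The suprema and infima below are those of the reals, hence unspecified on empty or
  unbounded sets. On nonempty compact sets they have their usual meaning. The empty set, which
  is not a point of the hyperspace, is given distance 0 to everything, because the locale
  \<open>Metric_space\<close> asks for nonnegativity and symmetry off the carrier too.\<close>

definition hausdorff_dist :: "('b \<Rightarrow> 'b \<Rightarrow> real) \<Rightarrow> 'b set \<Rightarrow> 'b set \<Rightarrow> real" where
  "hausdorff_dist \<rho> K L =
     (if K = {} \<or> L = {} then 0
      else max (SUP x\<in>K. INF y\<in>L. \<rho> x y) (SUP y\<in>L. INF x\<in>K. \<rho> x y))"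

text \<open>The lower and upper limits are taken in the extended reals, so that no boundedness of
  the metric has to be presupposed.\<close>

definition Li_Yorke_sensitive :: "'b set \<Rightarrow> ('b \<Rightarrow> 'b \<Rightarrow> real) \<Rightarrow> ('b \<Rightarrow> 'b) \<Rightarrow> bool" where
  "Li_Yorke_sensitive X \<rho> f \<longleftrightarrow>
     Metric_space X \<rho> \<and>
     continuous_map (Metric_space.mtopology X \<rho>) (Metric_space.mtopology X \<rho>) f \<and>
     (\<exists>\<delta>>0. \<forall>x\<in>X. \<forall>\<epsilon>>0. \<exists>y\<in>X. \<rho> x y < \<epsilon> \<and>
        liminf (\<lambda>n. ereal (\<rho> ((f ^^ n) x) ((f ^^ n) y))) = 0 \<and>
        limsup (\<lambda>n. ereal (\<rho> ((f ^^ n) x) ((f ^^ n) y))) > ereal \<delta>)"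

end

theory Submission
  imports Defs
begin

text \<open>Given a nonempty \<open>K\<close> and \<open>a \<noteq> b\<close> in \<open>A\<close>, overwrite, at the sparse positions \<open>2 ^ k\<close>
  with \<open>k \<ge> N\<close>, the letters of all the points of \<open>K\<close> by one common letter \<open>v (2 ^ k)\<close>, equal to
  \<open>a\<close> or to \<open>b\<close>, such that some point of \<open>K\<close> has at this position a letter at distance at least
  \<open>d a b / 2\<close> from it. The overwriting map is nonexpansive, so it preserves compactness, and it moves
  points little if \<open>N\<close> is large. After \<open>2 ^ k\<close> shifts some point of \<open>K\<close> is far from every
  overwritten point, whereas after \<open>2 ^ k + 1\<close> shifts every point agrees with its overwritten
  version on a long initial block. Applying this to \<open>K\<close> and to singletons gives both claims.\<close>

section \<open>The Hausdorff distance of a bounded metric\<close>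

text \<open>The bound is imposed on all arguments, inside the carrier or not, so that the real
  suprema and infima in \<open>hausdorff_dist\<close> are those of bounded families for arbitrary
  nonempty sets.\<close>

locale Bounded_metric_space = Metric_space +
  fixes B :: real
  assumes dist_le_bound: "d x y \<le> B"
begin

lemma bdd_below_dist: "bdd_below ((\<lambda>y. d x y) ` L)" "bdd_below ((\<lambda>y. d y x) ` L)"
  by (auto intro!: bdd_belowI2[where m = 0])

lemma bdd_above_INF_dist:
  assumes "L \<noteq> {}"
  shows "bdd_above ((\<lambda>x. INF y\<in>L. d x y) ` K)"
proof (rule bdd_aboveI2)
  fix x
  obtain y where "y \<in> L"
    using assms by blast
  then show "(INF y\<in>L. d x y) \<le> B"
    by (intro cINF_lower2[OF bdd_below_dist(1)] dist_le_bound)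
qed

lemma hausdorff_dist_commute: "hausdorff_dist d K L = hausdorff_dist d L K"
proof -
  have "(SUP x\<in>K. INF y\<in>L. d x y) = (SUP x\<in>K. INF y\<in>L. d y x)" for K L
    by (subst commute) (rule refl)
  from this[of K L] this[of L K] show ?thesis
    unfolding hausdorff_dist_def by (simp add: max.commute disj_commute)
qed

lemma hausdorff_dist_leI:
  assumes "K \<noteq> {}" "L \<noteq> {}"
    and "\<And>x. x \<in> K \<Longrightarrow> \<exists>y\<in>L. d x y \<le> r" "\<And>y. y \<in> L \<Longrightarrow> \<exists>x\<in>K. d x y \<le> r"
  shows "hausdorff_dist d K L \<le> r"
proof -
  have "(INF y\<in>L. d x y) \<le> r" if "x \<in> K" for x
  proof -
    obtain y where "y \<in> L" "d x y \<le> r"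
      using assms(3) \<open>x \<in> K\<close> by blast
    then show ?thesis
      by (rule cINF_lower2[OF bdd_below_dist(1)])
  qed
  then have "(SUP x\<in>K. INF y\<in>L. d x y) \<le> r"
    by (rule cSUP_least[OF assms(1)])
  moreover have "(INF x\<in>K. d x y) \<le> r" if "y \<in> L" for y
  proof -
    obtain x where "x \<in> K" "d x y \<le> r"
      using assms(4) \<open>y \<in> L\<close> by blast
    then show ?thesis
      by (rule cINF_lower2[OF bdd_below_dist(2)])
  qed
  then have "(SUP y\<in>L. INF x\<in>K. d x y) \<le> r"
    by (rule cSUP_least[OF assms(2)])
  ultimately show ?thesis
    using assms by (simp add: hausdorff_dist_def)
qed

text \<open>One large one-sided distance suffices, so a single point of \<open>K\<close> far from
  all of \<open>L\<close> is enough. The bound \<open>B\<close> enters here: it makes the supremum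
  over \<open>K\<close> dominate its value at \<open>x\<close>.\<close>

lemma hausdorff_dist_geI:
  assumes "x \<in> K" "L \<noteq> {}" "\<And>y. y \<in> L \<Longrightarrow> r \<le> d x y"
  shows "r \<le> hausdorff_dist d K L"
proof -
  have "r \<le> (INF y\<in>L. d x y)"
    using assms by (intro cINF_greatest) auto
  also have "\<dots> \<le> (SUP x\<in>K. INF y\<in>L. d x y)"
    using assms by (intro cSUP_upper bdd_above_INF_dist)
  finally show ?thesis
    using assms by (auto simp: hausdorff_dist_def)
qed

lemma hausdorff_dist_lessD:
  assumes "hausdorff_dist d K L < r" "x \<in> K" "L \<noteq> {}"
  obtains y where "y \<in> L" "d x y < r"
  using hausdorff_dist_geI[of x K L r] assms by (meson not_le)

lemma hausdorff_dist_nonneg: "0 \<le> hausdorff_dist d K L"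
proof (cases "K = {} \<or> L = {}")
  case True
  then show ?thesis
    by (auto simp: hausdorff_dist_def)
next
  case False
  then show ?thesis
    by (meson ex_in_conv hausdorff_dist_geI nonneg)
qed

lemma hausdorff_dist_triangle:
  assumes "K \<subseteq> M" "L \<subseteq> M" "N \<subseteq> M" "K \<noteq> {}" "L \<noteq> {}" "N \<noteq> {}"
  shows "hausdorff_dist d K N \<le> hausdorff_dist d K L + hausdorff_dist d L N"
proof (rule field_le_epsilon)
  fix e :: real
  assume "0 < e"
  \<comment> \<open>Infima need not be attained, so each of the two moves, from \<open>K\<close> to
    \<open>L\<close> and from \<open>L\<close> to \<open>N\<close>, costs a slack of
    \<open>e / 2\<close>. Only \<open>L\<close> is fixed, which lets the same fact serve with
    \<open>K\<close> and \<open>N\<close> exchanged.\<close>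
  have near: "\<exists>z\<in>N. d x z \<le> hausdorff_dist d K L + hausdorff_dist d L N + e"
    if K: "x \<in> K" "K \<subseteq> M" "L \<subseteq> M" "N \<subseteq> M" "L \<noteq> {}" "N \<noteq> {}" for x K N
  proof -
    obtain y where y: "y \<in> L" "d x y < hausdorff_dist d K L + e / 2"
      using hausdorff_dist_lessD[of K L "hausdorff_dist d K L + e / 2" x] K \<open>0 < e\<close> by auto
    obtain z where z: "z \<in> N" "d y z < hausdorff_dist d L N + e / 2"
      using hausdorff_dist_lessD[of L N "hausdorff_dist d L N + e / 2" y] K y \<open>0 < e\<close> by auto
    have "d x z \<le> d x y + d y z"
      using K y z by (intro triangle) auto
    then show ?thesis
      using y z by (intro bexI[of _ z]) auto
  qed
  show "hausdorff_dist d K N \<le> hausdorff_dist d K L + hausdorff_dist d L N + e"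
  proof (rule hausdorff_dist_leI)
    fix z
    assume "z \<in> N"
    then show "\<exists>x\<in>K. d x z \<le> hausdorff_dist d K L + hausdorff_dist d L N + e"
      using near[of z N K] assms
      by (simp add: commute hausdorff_dist_commute[of N] hausdorff_dist_commute[of L K] add.commute)
  qed (use assms near in auto)
qed

text \<open>Distance 0 gives points of \<open>L\<close> in every ball around a point of
  \<open>K\<close>, which therefore lies in the closure of \<open>L\<close>.\<close>

lemma hausdorff_dist_0_imp_subset:
  assumes "closedin mtopology L" "K \<subseteq> M" "L \<noteq> {}" "hausdorff_dist d K L = 0"
  shows "K \<subseteq> L"
proof
  fix x
  assume "x \<in> K"
  then have "\<exists>y\<in>L. y \<in> mball x r" if "r > 0" for r
    using hausdorff_dist_lessD[of K L r x] assms that closedin_subset[OF assms(1)]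
    by (metis in_mball subsetD topspace_mtopology)
  then have "x \<in> mtopology closure_of L"
    using assms \<open>x \<in> K\<close> by (auto simp: metric_closure_of)
  then show "x \<in> L"
    using assms by (simp add: closure_of_closedin)
qed

lemma hyperspaceD:
  assumes "K \<in> hyperspace M d"
  shows "K \<noteq> {}" "compactin mtopology K" "closedin mtopology K" "K \<subseteq> M"
  using assms compactin_imp_closedin[OF Hausdorff_space_mtopology] compactin_subset_topspace
  by (force simp: hyperspace_def)+

text \<open>Compact sets are closed here, so distance 0 forces both inclusions. Nonnegativity and
  symmetry are demanded for arbitrary sets, and the convention for the empty set provides
  them.\<close>

lemma Metric_space_hausdorff_dist: "Metric_space (hyperspace M d) (hausdorff_dist d)"
proof
  fix K L
  assume K: "K \<in> hyperspace M d" and L: "L \<in> hyperspace M d"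
  show "hausdorff_dist d K L = 0 \<longleftrightarrow> K = L"
  proof
    assume "hausdorff_dist d K L = 0"
    then show "K = L"
      using hausdorff_dist_0_imp_subset hyperspaceD K L
      by (metis hausdorff_dist_commute subset_antisym)
  next
    assume "K = L"
    moreover have "d x x \<le> 0" if "x \<in> L" for x
      using hyperspaceD(4)[OF L] that by auto
    ultimately have "hausdorff_dist d K L \<le> 0"
      using hyperspaceD(1)[OF L] by (intro hausdorff_dist_leI) auto
    then show "hausdorff_dist d K L = 0"
      using hausdorff_dist_nonneg[of K L] by simp
  qed
next
  fix K L N
  assume "K \<in> hyperspace M d" "L \<in> hyperspace M d" "N \<in> hyperspace M d"
  then show "hausdorff_dist d K N \<le> hausdorff_dist d K L + hausdorff_dist d L N"
    by (simp add: hausdorff_dist_triangle hyperspaceD)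
qed (simp_all add: hausdorff_dist_nonneg hausdorff_dist_commute)

lemma hausdorff_dist_image_le:
  assumes "K \<subseteq> M" "L \<subseteq> M" "K \<noteq> {}" "L \<noteq> {}" "0 \<le> C"
    and lip: "\<And>x y. x \<in> M \<Longrightarrow> y \<in> M \<Longrightarrow> d (f x) (f y) \<le> C * d x y"
  shows "hausdorff_dist d (f ` K) (f ` L) \<le> C * hausdorff_dist d K L"
proof (rule field_le_epsilon)
  fix e :: real
  assume "0 < e"
  \<comment> \<open>The divisor is \<open>C + 1\<close> and not \<open>C\<close>, since
    \<open>C\<close> may be 0.\<close>
  define e' where "e' = e / (C + 1)"
  have e': "0 < e'" "C * e' \<le> e"
    using \<open>0 < e\<close> \<open>0 \<le> C\<close> by (auto simp: e'_def field_simps)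
  have near: "\<exists>y\<in>L. d (f x) (f y) \<le> C * hausdorff_dist d K L + e"
    if K: "x \<in> K" "K \<subseteq> M" "L \<subseteq> M" "L \<noteq> {}" for x K L
  proof -
    obtain y where y: "y \<in> L" "d x y < hausdorff_dist d K L + e'"
      using hausdorff_dist_lessD[of K L "hausdorff_dist d K L + e'" x] K e' by auto
    have "d (f x) (f y) \<le> C * d x y"
      using lip K y by auto
    also have "\<dots> \<le> C * (hausdorff_dist d K L + e')"
      using y \<open>0 \<le> C\<close> by (intro mult_left_mono) auto
    finally have "d (f x) (f y) \<le> C * hausdorff_dist d K L + e"
      using e'(2) by (simp add: algebra_simps)
    then show ?thesis
      using y by blast
  qed
  show "hausdorff_dist d (f ` K) (f ` L) \<le> C * hausdorff_dist d K L + e"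
  proof (rule hausdorff_dist_leI)
    fix y
    assume "y \<in> f ` L"
    then show "\<exists>x\<in>f ` K. d x y \<le> C * hausdorff_dist d K L + e"
      using near[of _ L K] assms by (auto simp: commute hausdorff_dist_commute[of L K])
  next
    fix x
    assume "x \<in> f ` K"
    then show "\<exists>y\<in>f ` L. d x y \<le> C * hausdorff_dist d K L + e"
      using near[of _ K L] assms by auto
  qed (use assms in auto)
qed

end

section \<open>Lipschitz maps: continuity and action on compact sets\<close>

lemma (in Metric_space) Lipschitz_imp_continuous_map:
  assumes "f ` M \<subseteq> M" "\<And>x y. x \<in> M \<Longrightarrow> y \<in> M \<Longrightarrow> d (f x) (f y) \<le> C * d x y" "0 < C"
  shows "continuous_map mtopology mtopology f"
  unfolding metric_continuous_map[OF Metric_space_axioms]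
proof (intro conjI ballI allI impI)
  fix a \<epsilon>
  assume "a \<in> M" "0 < (\<epsilon>::real)"
  then show "\<exists>\<delta>>0. \<forall>x. x \<in> M \<and> d a x < \<delta> \<longrightarrow> d (f a) (f x) < \<epsilon>"
    using assms(2)[of a] \<open>0 < C\<close>
    by (intro exI[of _ "\<epsilon> / C"]) (force simp: field_simps intro: le_less_trans)
qed (use assms in auto)

lemma (in Bounded_metric_space) Lipschitz_imp_image_hyperspace:
  assumes "f ` M \<subseteq> M" "\<And>x y. x \<in> M \<Longrightarrow> y \<in> M \<Longrightarrow> d (f x) (f y) \<le> C * d x y" "0 < C"
    and "K \<in> hyperspace M d"
  shows "f ` K \<in> hyperspace M d"
  using image_compactin[OF _ Lipschitz_imp_continuous_map[OF assms(1-3)]] assms(4)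
  by (auto simp: hyperspace_def)

section \<open>Shift spaces\<close>

text \<open>Passing to a subsequence can only raise the lower limit and only lower the upper
  limit.\<close>

lemma liminf_limsup_along_subsequences:
  fixes f :: "nat \<Rightarrow> real" and r s :: "nat \<Rightarrow> nat"
  assumes "\<And>n. 0 \<le> f n"
    and "strict_mono r" "(\<lambda>k. f (r k)) \<longlonglongrightarrow> 0"
    and "strict_mono s" "\<And>k. c \<le> f (s k)"
  shows "liminf (\<lambda>n. ereal (f n)) = 0" "ereal c \<le> limsup (\<lambda>n. ereal (f n))"
proof -
  have "(\<lambda>k. ereal (f (r k))) \<longlonglongrightarrow> 0"
    using assms(3) by (simp add: zero_ereal_def)
  then have "liminf ((\<lambda>n. ereal (f n)) \<circ> r) = 0"
    by (simp add: o_def lim_imp_Liminf)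
  moreover have "liminf (\<lambda>n. ereal (f n)) \<le> liminf ((\<lambda>n. ereal (f n)) \<circ> r)"
    by (rule liminf_subseq_mono[OF assms(2)])
  moreover have "0 \<le> liminf (\<lambda>n. ereal (f n))"
    using assms(1) by (intro Liminf_bounded) auto
  ultimately show "liminf (\<lambda>n. ereal (f n)) = 0"
    by simp
  have "ereal c \<le> limsup ((\<lambda>n. ereal (f n)) \<circ> s)"
    using assms(5) by (intro le_Limsup) auto
  also have "\<dots> \<le> limsup (\<lambda>n. ereal (f n))"
    by (rule limsup_subseq_mono[OF assms(4)])
  finally show "ereal c \<le> limsup (\<lambda>n. ereal (f n))" .
qed

text \<open>Common reduction of both claims to a perturbation statement: the times
  \<open>2 ^ k + 1\<close> force the lower limit to be 0, the times \<open>2 ^ k\<close> keep the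
  upper limit at least \<open>c\<close>.\<close>

lemma Li_Yorke_sensitiveI:
  fixes X :: "'b set"
  assumes metric: "Metric_space X \<rho>"
    and Lipschitz: "f ` X \<subseteq> X" "\<And>x y. x \<in> X \<Longrightarrow> y \<in> X \<Longrightarrow> \<rho> (f x) (f y) \<le> C * \<rho> x y" "0 < C"
    and "0 < c"
    and perturb: "\<And>x N. x \<in> X \<Longrightarrow> \<exists>y\<in>X. \<rho> x y \<le> 2 / 2 ^ N \<and>
      (\<forall>k. \<rho> ((f ^^ (2 ^ k + 1)) x) ((f ^^ (2 ^ k + 1)) y) \<le> 2 / 2 ^ k) \<and>
      (\<forall>k\<ge>N. c \<le> \<rho> ((f ^^ 2 ^ k) x) ((f ^^ 2 ^ k) y))"
  shows "Li_Yorke_sensitive X \<rho> f"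
  unfolding Li_Yorke_sensitive_def
\<comment> \<open>The subsequence argument only yields an upper limit of at least \<open>c\<close>;
  halving makes the inequality strict.\<close>
proof (intro conjI exI[of _ "c / 2"] ballI allI impI)
  interpret Metric_space X \<rho>
    by (rule metric)
  show "continuous_map mtopology mtopology f"
    using Lipschitz by (rule Lipschitz_imp_continuous_map)
  fix x \<epsilon>
  assume "x \<in> X" "0 < (\<epsilon>::real)"
  have lim: "(\<lambda>k. 2 / 2 ^ k :: real) \<longlonglongrightarrow> 0"
    using tendsto_mult_right_zero[OF LIMSEQ_power_zero[of "1/2 :: real"], of 2]
    by (simp add: power_divide)
  then obtain N where N: "2 / 2 ^ N < \<epsilon>"
    using order_tendstoD(2)[OF lim \<open>0 < \<epsilon>\<close>] by (auto simp: eventually_sequentially)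
  obtain y where y: "y \<in> X" "\<rho> x y \<le> 2 / 2 ^ N"
      "\<And>k. \<rho> ((f ^^ (2 ^ k + 1)) x) ((f ^^ (2 ^ k + 1)) y) \<le> 2 / 2 ^ k"
      "\<And>k. k \<ge> N \<Longrightarrow> c \<le> \<rho> ((f ^^ 2 ^ k) x) ((f ^^ 2 ^ k) y)"
    using perturb[OF \<open>x \<in> X\<close>, of N] by blast
  define h where "h n = \<rho> ((f ^^ n) x) ((f ^^ n) y)" for n
  have "(\<lambda>k. h (2 ^ k + 1)) \<longlonglongrightarrow> 0"
    using y(3) by (intro tendsto_sandwich[OF _ _ tendsto_const lim] always_eventually)
      (auto simp: h_def simp del: funpow.simps)
  \<comment> \<open>The exponent \<open>k + N\<close> skips the early times, as separation is only
    assumed from \<open>N\<close> on.\<close>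
  then have "liminf (\<lambda>n. ereal (h n)) = 0" "ereal c \<le> limsup (\<lambda>n. ereal (h n))"
    using y(4) liminf_limsup_along_subsequences[of h "\<lambda>k. 2 ^ k + 1" "\<lambda>k. 2 ^ (k + N)" c]
    by (auto simp: h_def strict_mono_def simp del: funpow.simps)
  moreover have "ereal (c / 2) < ereal c"
    using \<open>0 < c\<close> by simp
  ultimately show "\<exists>y\<in>X. \<rho> x y < \<epsilon> \<and> liminf (\<lambda>n. ereal (\<rho> ((f ^^ n) x) ((f ^^ n) y))) = 0 \<and>
      ereal (c / 2) < limsup (\<lambda>n. ereal (\<rho> ((f ^^ n) x) ((f ^^ n) y)))"
    using y(1,2) N unfolding h_def by (meson le_less_trans less_le_trans)
qed (use metric \<open>0 < c\<close> in simp_all)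

lemma in_full_shift_iff: "x \<in> full_shift A \<longleftrightarrow> (\<forall>i. x i \<in> A)"
  by (auto simp: full_shift_def)

lemma funpow_shift: "(shift ^^ n) x = (\<lambda>i. x (n + i))"
  by (induction n) (auto simp: shift_def)

lemma funpow_image:
  fixes f :: "'a \<Rightarrow> 'a"
  shows "(((`) f) ^^ n) K = (f ^^ n) ` K"
  by (induction n) (auto simp: image_comp)

lemma shift_in_full_shift: "x \<in> full_shift A \<Longrightarrow> shift x \<in> full_shift A"
  by (simp add: in_full_shift_iff shift_def)

definition overwrite :: "nat set \<Rightarrow> (nat \<Rightarrow> 'a) \<Rightarrow> (nat \<Rightarrow> 'a) \<Rightarrow> nat \<Rightarrow> 'a" where
  "overwrite S v x = (\<lambda>i. if i \<in> S then v i else x i)"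

section \<open>The sequence metric over a bounded letter metric\<close>

text \<open>A common frame for the two kinds of alphabet: \<open>g\<close> is instantiated by the
  discrete metric and by d/(1+d). The bound 1 for all arguments makes the weighted series converge
  for arbitrary sequences.\<close>

locale Alphabet = Metric_space A g for A :: "'a set" and g +
  assumes letter_dist_le_1: "g x y \<le> 1"
begin

definition seq_dist :: "(nat \<Rightarrow> 'a) \<Rightarrow> (nat \<Rightarrow> 'a) \<Rightarrow> real" where
  "seq_dist x y = (\<Sum>i. g (x i) (y i) / 2 ^ i)"

lemma summable_inverse_power_2: "summable (\<lambda>i. 1 / 2 ^ i :: real)"
  using summable_geometric[of "1/2 :: real"] by (simp add: power_divide)

lemma suminf_inverse_power_2: "(\<Sum>i. 1 / 2 ^ i :: real) = 2"
  using suminf_geometric[of "1/2 :: real"] by (simp add: power_divide)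

lemma summable_seq_dist: "summable (\<lambda>i. g (x i) (y i) / 2 ^ i)"
  by (rule summable_comparison_test'[OF summable_inverse_power_2, of 0])
     (simp add: divide_right_mono letter_dist_le_1)

lemma letter_dist_le_seq_dist: "g (x 0) (y 0) \<le> seq_dist x y"
  using sum_le_suminf[OF summable_seq_dist[of x y], of "{0}"] by (simp add: seq_dist_def)

lemma seq_dist_le_2: "seq_dist x y \<le> 2"
proof -
  have "seq_dist x y \<le> (\<Sum>i. 1 / 2 ^ i)"
    unfolding seq_dist_def
    by (intro suminf_le summable_seq_dist summable_inverse_power_2)
       (simp add: divide_right_mono letter_dist_le_1)
  then show ?thesis
    by (simp only: suminf_inverse_power_2)
qed

lemma seq_dist_nonneg: "0 \<le> seq_dist x y"
  unfolding seq_dist_def by (intro suminf_nonneg summable_seq_dist) simp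

text \<open>Splitting off the first letter yields both the Lipschitz constant 2 of the shift and the
  induction for sequences with a common initial block.\<close>

lemma seq_dist_unfold: "seq_dist x y = g (x 0) (y 0) + seq_dist (shift x) (shift y) / 2"
proof -
  have "seq_dist x y = g (x 0) (y 0) + (\<Sum>i. g (x (Suc i)) (y (Suc i)) / 2 ^ Suc i)"
    using suminf_split_head[OF summable_seq_dist[of x y]] by (simp add: seq_dist_def)
  also have "(\<Sum>i. g (x (Suc i)) (y (Suc i)) / 2 ^ Suc i) = seq_dist (shift x) (shift y) / 2"
    using suminf_divide[OF summable_seq_dist[of "shift x" "shift y"], of 2]
    by (simp add: seq_dist_def shift_def mult.commute)
  finally show ?thesis .
qed

lemma seq_dist_shift_le: "seq_dist (shift x) (shift y) \<le> 2 * seq_dist x y"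
  using seq_dist_unfold[of x y] nonneg[of "x 0" "y 0"] by linarith

text \<open>Starting from the global bound 2, each further agreeing letter halves the estimate.
  Since \<open>x\<close> has its letters in \<open>A\<close>, \<open>g\<close> vanishes at the
  agreeing positions.\<close>

lemma seq_dist_le_if_agree:
  assumes "x \<in> full_shift A" "\<And>i. i < m \<Longrightarrow> x i = y i"
  shows "seq_dist x y \<le> 2 / 2 ^ m"
  using assms
proof (induction m arbitrary: x y)
  case 0
  then show ?case
    by (simp add: seq_dist_le_2)
next
  case (Suc m)
  have "seq_dist (shift x) (shift y) \<le> 2 / 2 ^ m"
    using Suc.prems by (intro Suc.IH) (auto simp: shift_def in_full_shift_iff)
  moreover have "g (x 0) (y 0) = 0"
    using Suc.prems(1) Suc.prems(2)[of 0] by (metis in_full_shift_iff mdist_zero zero_less_Suc)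
  ultimately show ?case
    using seq_dist_unfold[of x y] by simp
qed

lemma seq_dist_mono:
  assumes "\<And>i. g (x i) (y i) \<le> g (x' i) (y' i)"
  shows "seq_dist x y \<le> seq_dist x' y'"
  unfolding seq_dist_def
  by (intro suminf_le summable_seq_dist) (simp add: divide_right_mono assms)

lemma Bounded_metric_space_seq_dist: "Bounded_metric_space (full_shift A) seq_dist 2"
proof
  fix x y
  assume xy: "x \<in> full_shift A" "y \<in> full_shift A"
  have "seq_dist x y = 0 \<longleftrightarrow> (\<forall>i. g (x i) (y i) / 2 ^ i = 0)"
    unfolding seq_dist_def by (rule suminf_eq_zero_iff[OF summable_seq_dist]) simp
  also have "\<dots> \<longleftrightarrow> x = y"
    using xy by (auto simp: in_full_shift_iff)
  finally show "seq_dist x y = 0 \<longleftrightarrow> x = y" .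
next
  fix x y z
  assume xyz: "x \<in> full_shift A" "y \<in> full_shift A" "z \<in> full_shift A"
  have "seq_dist x z \<le> (\<Sum>i. g (x i) (y i) / 2 ^ i + g (y i) (z i) / 2 ^ i)"
    unfolding seq_dist_def
  proof (intro suminf_le summable_seq_dist summable_add)
    fix i
    have "g (x i) (z i) \<le> g (x i) (y i) + g (y i) (z i)"
      using xyz by (intro triangle) (auto simp: in_full_shift_iff)
    then show "g (x i) (z i) / 2 ^ i \<le> g (x i) (y i) / 2 ^ i + g (y i) (z i) / 2 ^ i"
      by (simp add: field_simps)
  qed
  then show "seq_dist x z \<le> seq_dist x y + seq_dist y z"
    by (simp add: seq_dist_def suminf_add[OF summable_seq_dist summable_seq_dist])
next
  fix x y
  show "seq_dist x y = seq_dist y x"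
    unfolding seq_dist_def by (subst commute) (rule refl)
qed (simp_all add: seq_dist_nonneg seq_dist_le_2)

sublocale Sequences: Bounded_metric_space "full_shift A" seq_dist 2
  by (rule Bounded_metric_space_seq_dist)

section \<open>Overwriting letters at the powers of two\<close>

text \<open>On \<open>S\<close> both new sequences carry the same letter of \<open>A\<close>, at
  distance 0 from itself; elsewhere the letters are unchanged.\<close>

lemma seq_dist_overwrite_le:
  assumes "\<And>i. v i \<in> A"
  shows "seq_dist (overwrite S v x) (overwrite S v y) \<le> seq_dist x y"
  using assms by (intro seq_dist_mono) (simp add: overwrite_def)

lemma overwrite_in_full_shift:
  "\<lbrakk>\<And>i. v i \<in> A; x \<in> full_shift A\<rbrakk> \<Longrightarrow> overwrite S v x \<in> full_shift A"
  by (simp add: overwrite_def in_full_shift_iff)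

text \<open>By the triangle inequality no letter of \<open>A\<close> is closer than
  \<open>g a b / 2\<close> to both \<open>a\<close> and \<open>b\<close>. So if \<open>a\<close>
  fails at position \<open>n\<close>, then \<open>b\<close> works there with any point of
  \<open>K\<close>.\<close>

lemma ex_far_letters:
  assumes "a \<in> A" "b \<in> A" "K \<subseteq> full_shift A" "K \<noteq> {}"
  obtains v where "\<And>n. v n \<in> A" "\<And>n. \<exists>x\<in>K. g a b / 2 \<le> g (x n) (v n)"
proof -
  have "\<exists>w\<in>A. \<exists>x\<in>K. g a b / 2 \<le> g (x n) w" for n
  proof (cases "\<exists>x\<in>K. g a b / 2 \<le> g (x n) a")
    case False
    obtain x where "x \<in> K"
      using assms by blast
    with False have "g (x n) a < g a b / 2"
      by force
    moreover have "g a b \<le> g (x n) a + g (x n) b"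
      using assms \<open>x \<in> K\<close> by (intro triangle'') (auto simp: in_full_shift_iff)
    ultimately show ?thesis
      using assms \<open>x \<in> K\<close> by (intro bexI[of _ b] bexI[of _ x]) auto
  qed (use assms in blast)
  then show ?thesis
    using that by metis
qed

lemma seq_dist_overwrite_powers_le:
  assumes "x \<in> full_shift A"
  shows "seq_dist x (overwrite {2 ^ k |k. N \<le> k} v x) \<le> 2 / 2 ^ N"
    and "seq_dist ((shift ^^ (2 ^ k + 1)) x)
      ((shift ^^ (2 ^ k + 1)) (overwrite {2 ^ k |k. N \<le> k} v x)) \<le> 2 / 2 ^ k"
proof -
  \<comment> \<open>Overwritten positions satisfy \<open>2 ^ k > k\<close> and
    \<open>k \<ge> N\<close>, so the first \<open>N\<close> letters survive.\<close>
  have "2 ^ k \<noteq> i" if "i < N" "N \<le> k" for i k :: nat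
    using that less_exp[of k] by linarith
  then show "seq_dist x (overwrite {2 ^ k |k. N \<le> k} v x) \<le> 2 / 2 ^ N"
    using assms by (intro seq_dist_le_if_agree) (auto simp: overwrite_def)
  \<comment> \<open>For \<open>i < k\<close> the position \<open>2 ^ k + 1 + i\<close> is at most
    \<open>2 ^ k + k\<close>, hence strictly between two consecutive powers of 2. This window of
    \<open>k\<close> untouched letters exists for every \<open>k\<close>, whether below
    \<open>N\<close> or not.\<close>
  have "2 ^ k + 1 + i \<noteq> 2 ^ j" if "i < k" for i j :: nat
  proof
    assume eq: "2 ^ k + 1 + i = (2::nat) ^ j"
    have "(2::nat) ^ k < 2 ^ j" "(2::nat) ^ j < 2 ^ Suc k"
      using eq that less_exp[of k] unfolding power_Suc by linarith+
    then have "k < j" "j < Suc k"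
      by (simp_all only: power_strict_increasing_iff one_less_numeral_iff semiring_norm(76))
    then show False
      by simp
  qed
  then show "seq_dist ((shift ^^ (2 ^ k + 1)) x)
      ((shift ^^ (2 ^ k + 1)) (overwrite {2 ^ k |k. N \<le> k} v x)) \<le> 2 / 2 ^ k"
    using assms unfolding funpow_shift
    by (intro seq_dist_le_if_agree) (auto simp: overwrite_def in_full_shift_iff)
qed

text \<open>After \<open>n\<close> shifts every overwritten sequence starts with \<open>v n\<close>,
  whatever \<open>y\<close> was. Hence one \<open>x\<close> is far from all overwritten points at
  once, which a lower bound on the Hausdorff distance requires.\<close>

lemma letter_dist_le_seq_dist_overwrite:
  assumes "n \<in> S"
  shows "g (x n) (v n) \<le> seq_dist ((shift ^^ n) x) ((shift ^^ n) (overwrite S v y))"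
  using letter_dist_le_seq_dist[of "(shift ^^ n) x" "(shift ^^ n) (overwrite S v y)"] assms
  by (simp add: funpow_shift overwrite_def)

section \<open>Sensitivity of the shift and of its induced map\<close>

theorem Li_Yorke_sensitive_shift:
  assumes "a \<in> A" "b \<in> A" "a \<noteq> b"
  shows "Li_Yorke_sensitive (full_shift A) seq_dist shift"
proof (rule Li_Yorke_sensitiveI[where c = "g a b / 2" and C = 2])
  fix x N
  assume x: "x \<in> full_shift A"
  \<comment> \<open>For the singleton \<open>{x}\<close> the letters of \<open>v\<close> are far
    from those of \<open>x\<close> itself.\<close>
  obtain v where v: "\<And>n. v n \<in> A" "\<And>n. g a b / 2 \<le> g (x n) (v n)"
    using ex_far_letters[of a b "{x}"] assms x by auto
  define y where "y = overwrite {2 ^ k |k. N \<le> k} v x"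
  have "y \<in> full_shift A"
    using v x by (simp add: y_def overwrite_in_full_shift)
  moreover have "g a b / 2 \<le> seq_dist ((shift ^^ 2 ^ k) x) ((shift ^^ 2 ^ k) y)" if "k \<ge> N" for k
    unfolding y_def using that
    by (intro order_trans[OF v(2)[of "2 ^ k"]] letter_dist_le_seq_dist_overwrite) auto
  ultimately show "\<exists>y\<in>full_shift A. seq_dist x y \<le> 2 / 2 ^ N \<and>
      (\<forall>k. seq_dist ((shift ^^ (2 ^ k + 1)) x) ((shift ^^ (2 ^ k + 1)) y) \<le> 2 / 2 ^ k) \<and>
      (\<forall>k\<ge>N. g a b / 2 \<le> seq_dist ((shift ^^ 2 ^ k) x) ((shift ^^ 2 ^ k) y))"
    using seq_dist_overwrite_powers_le[OF x, where N = N and v = v] unfolding y_def by blast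
qed (use assms shift_in_full_shift seq_dist_shift_le Sequences.Metric_space_axioms in auto)

theorem Li_Yorke_sensitive_image_shift:
  assumes "a \<in> A" "b \<in> A" "a \<noteq> b"
  shows "Li_Yorke_sensitive (hyperspace (full_shift A) seq_dist) (hausdorff_dist seq_dist) ((`) shift)"
    (is "Li_Yorke_sensitive ?H ?h _")
proof (rule Li_Yorke_sensitiveI[where c = "g a b / 2" and C = 2])
  show "Metric_space ?H ?h"
    by (rule Sequences.Metric_space_hausdorff_dist)
  show "(`) shift ` ?H \<subseteq> ?H"
    by (auto intro!: Sequences.Lipschitz_imp_image_hyperspace[where C = 2]
        shift_in_full_shift seq_dist_shift_le)
  show "?h (shift ` K) (shift ` L) \<le> 2 * ?h K L" if "K \<in> ?H" "L \<in> ?H" for K L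
    using that Sequences.hyperspaceD seq_dist_shift_le
    by (intro Sequences.hausdorff_dist_image_le) auto
next
  fix K N
  assume K: "K \<in> ?H"
  note K_sub = Sequences.hyperspaceD(1,4)[OF K]
  obtain v where v: "\<And>n. v n \<in> A" "\<And>n. \<exists>x\<in>K. g a b / 2 \<le> g (x n) (v n)"
    using ex_far_letters[of a b K] assms K_sub by auto
  define F where "F = overwrite {2 ^ k |k. N \<le> k} v"
  have "F ` K \<in> ?H"
    unfolding F_def using v K
    by (intro Sequences.Lipschitz_imp_image_hyperspace[where C = 1])
       (auto simp: overwrite_in_full_shift seq_dist_overwrite_le)
  \<comment> \<open>Pairing each \<open>x\<close> in \<open>K\<close> with \<open>F x\<close>
    controls both one-sided distances; the next estimate uses the same pairing after
    shifting.\<close>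
  moreover have "?h K (F ` K) \<le> 2 / 2 ^ N"
    using K_sub seq_dist_overwrite_powers_le(1)[of _ N v]
    by (intro Sequences.hausdorff_dist_leI) (auto simp: F_def)
  moreover have "?h ((shift ^^ (2 ^ k + 1)) ` K) ((shift ^^ (2 ^ k + 1)) ` F ` K) \<le> 2 / 2 ^ k" for k
    using K_sub seq_dist_overwrite_powers_le(2)[of _ k N v]
    by (intro Sequences.hausdorff_dist_leI) (auto simp: F_def simp del: funpow.simps)
  moreover have "g a b / 2 \<le> ?h ((shift ^^ 2 ^ k) ` K) ((shift ^^ 2 ^ k) ` F ` K)" if "k \<ge> N" for k
  proof -
    \<comment> \<open>The witness may change with \<open>k\<close>; only the family \<open>v\<close>
      has to be fixed beforehand.\<close>
    obtain x where x: "x \<in> K" "g a b / 2 \<le> g (x (2 ^ k)) (v (2 ^ k))"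
      using v(2) by blast
    have "g a b / 2 \<le> seq_dist ((shift ^^ 2 ^ k) x) ((shift ^^ 2 ^ k) (F y))" for y
      unfolding F_def using that
      by (intro order_trans[OF x(2)] letter_dist_le_seq_dist_overwrite) auto
    then show ?thesis
      using K_sub x(1) by (intro Sequences.hausdorff_dist_geI[of "(shift ^^ 2 ^ k) x"]) auto
  qed
  ultimately show "\<exists>L\<in>?H. ?h K L \<le> 2 / 2 ^ N \<and>
      (\<forall>k. ?h ((((`) shift) ^^ (2 ^ k + 1)) K) ((((`) shift) ^^ (2 ^ k + 1)) L) \<le> 2 / 2 ^ k) \<and>
      (\<forall>k\<ge>N. g a b / 2 \<le> ?h ((((`) shift) ^^ 2 ^ k) K) ((((`) shift) ^^ 2 ^ k) L))"
    unfolding funpow_image by blast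
qed (use assms in auto)

end

section \<open>The discrete and the normalized letter metrics\<close>

lemma Alphabet_discrete: "Alphabet A discrete_metric.dd"
  by unfold_locales (auto simp: discrete_metric.dd_def)

text \<open>The function t/(1+t) is increasing and subadditive for t \<ge> 0. Monotonicity passes
  from \<open>d x z\<close> to the sum \<open>d x y + d y z\<close>; subadditivity follows by
  dropping one summand from each denominator.\<close>

lemma Alphabet_normalized:
  assumes "Metric_space A d"
  shows "Alphabet A (\<lambda>x y. d x y / (1 + d x y))"
proof -
  interpret Metric_space A d
    by fact
  have pos: "0 < 1 + d x y" for x y
    by (simp add: add_pos_nonneg)
  show ?thesis
  proof
    fix x y
    show "d x y / (1 + d x y) \<le> 1"
      using pos[of x y] by simp
    show "d x y / (1 + d x y) = d y x / (1 + d y x)"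
      by (simp add: commute)
    assume "x \<in> A" "y \<in> A"
    then show "d x y / (1 + d x y) = 0 \<longleftrightarrow> x = y"
      using pos[of x y] by auto
  next
    fix x y z
    assume "x \<in> A" "y \<in> A" "z \<in> A"
    then have "d x z \<le> d x y + d y z"
      by (rule triangle)
    then have "d x z / (1 + d x z) \<le> (d x y + d y z) / (1 + (d x y + d y z))"
      using pos[of x z] pos[of x y] nonneg[of y z] by (simp add: divide_simps algebra_simps)
    also have "\<dots> = d x y / (1 + (d x y + d y z)) + d y z / (1 + (d x y + d y z))"
      by (rule add_divide_distrib)
    also have "\<dots> \<le> d x y / (1 + d x y) + d y z / (1 + d y z)"
      using pos by (intro add_mono divide_left_mono mult_pos_pos) (auto simp: add_pos_nonneg)
    finally show "d x z / (1 + d x z) \<le> d x y / (1 + d x y) + d y z / (1 + d y z)" .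
  qed simp
qed

theorem proposition3p4:
  fixes A :: "'a set"
  assumes "\<exists>a\<in>A. \<exists>b\<in>A. a \<noteq> b"
  shows "(Li_Yorke_sensitive (full_shift A) seq_dist_discrete shift \<and>
          Li_Yorke_sensitive (hyperspace (full_shift A) seq_dist_discrete)
            (hausdorff_dist seq_dist_discrete) (\<lambda>K. shift ` K)) \<and>
         (\<forall>d. Metric_space A d \<longrightarrow>
            Li_Yorke_sensitive (full_shift A) (seq_dist_metric d) shift \<and>
            Li_Yorke_sensitive (hyperspace (full_shift A) (seq_dist_metric d))
              (hausdorff_dist (seq_dist_metric d)) (\<lambda>K. shift ` K))"
proof (intro conjI allI impI)
  obtain a b where ab: "a \<in> A" "b \<in> A" "a \<noteq> b"
    using assms by blast
  interpret Discrete: Alphabet A discrete_metric.dd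
    by (rule Alphabet_discrete)
  have eq: "seq_dist_discrete = Discrete.seq_dist"
    by (intro ext) (simp add: seq_dist_discrete_def Discrete.seq_dist_def)
  show "Li_Yorke_sensitive (full_shift A) seq_dist_discrete shift"
    unfolding eq by (rule Discrete.Li_Yorke_sensitive_shift[OF ab])
  show "Li_Yorke_sensitive (hyperspace (full_shift A) seq_dist_discrete)
      (hausdorff_dist seq_dist_discrete) (\<lambda>K. shift ` K)"
    unfolding eq by (rule Discrete.Li_Yorke_sensitive_image_shift[OF ab])
next
  fix d
  assume "Metric_space A d"
  obtain a b where ab: "a \<in> A" "b \<in> A" "a \<noteq> b"
    using assms by blast
  interpret Normalized: Alphabet A "\<lambda>x y. d x y / (1 + d x y)"
    by (rule Alphabet_normalized) fact
  \<comment> \<open>The two series differ only in how the weight \<open>1 / 2 ^ i\<close> is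
    written.\<close>
  have eq: "seq_dist_metric d = Normalized.seq_dist"
    by (intro ext) (simp add: seq_dist_metric_def Normalized.seq_dist_def mult.commute)
  show "Li_Yorke_sensitive (full_shift A) (seq_dist_metric d) shift"
    unfolding eq by (rule Normalized.Li_Yorke_sensitive_shift[OF ab])
  show "Li_Yorke_sensitive (hyperspace (full_shift A) (seq_dist_metric d))
      (hausdorff_dist (seq_dist_metric d)) (\<lambda>K. shift ` K)"
    unfolding eq by (rule Normalized.Li_Yorke_sensitive_image_shift[OF ab])
qed

end
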